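(* Let $G$ be a finite non-trivial abelian group. If $|G|$ is even and $G$ is of type $(m_1,\ldots,m_{\operatorname{rk}(G)})$, then $$ s_{\min}(G)=\begin{cases}\operatorname{rk}(G) & \text{if } m_1=2,\\ \operatorname{rk}(G)+1 & \text{if } m_1>2.\end{cases}$$ If $|G|$ is odd, then $\operatorname{rk}(G)+1\le s_{\min}(G)\le 2\operatorname{rk}(G)+1$.
   Context: For a finite abelian group $G$ with $n=|G|$, let $\mathcal C(G)$ be the set of Hamiltonian cycles in the complete digraph on vertex set $G$; a cycle is written $C=(g_1,\ldots,g_n)$, a listing of all elements of $G$, indices modulo $n$. Let $S(C)=\{g_i+g_{i+1} : 1\le i\le n\}$ (indices mod $n$) be the set of sums of consecutive elements, and $s_{\min}(G)=\min\{|S(C)| : C\in\mathcal C(G)\}$. $\operatorname{rk}(G)$ is the rank of $G$ (minimum number of generators). "$G$ is of type $(m_1,\ldots,m_r)$" means $G\cong \mathbb Z/m_1\mathbb Z\oplus\cdots\oplus\mathbb Z/m_r\mathbb Z$ with $1<m_1\mid m_2\mid\cdots\mid m_r$ (invariant factor decomposition), $r=\operatorname{rk}(G)$. *)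

theory Defs
  imports "HOL-Algebra.Algebra"
begin

(* HOL-Algebra writes groups multiplicatively: the sum g + h is g \<otimes> h.
   A Hamiltonian cycle of the complete digraph on the group is given by a listing of all
   elements, read cyclically. Its rotations give the same set of consecutive sums, so the
   minimum below is not affected by listing a cycle from different starting points. *)

definition hamiltonian_cycles :: "('a, 'b) monoid_scheme \<Rightarrow> 'a list set" where
  "hamiltonian_cycles G = {C. distinct C \<and> set C = carrier G}"

definition consecutive_sums :: "('a, 'b) monoid_scheme \<Rightarrow> 'a list \<Rightarrow> 'a set" where
  "consecutive_sums G C =
     {C ! i \<otimes>\<^bsub>G\<^esub> C ! (Suc i mod length C) | i. i < length C}"

definition s_min :: "('a, 'b) monoid_scheme \<Rightarrow> nat" where
  "s_min G = Min {card (consecutive_sums G C) | C. C \<in> hamiltonian_cycles G}"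

definition group_rank :: "('a, 'b) monoid_scheme \<Rightarrow> nat" where
  "group_rank G =
     (LEAST k. \<exists>A. A \<subseteq> carrier G \<and> finite A \<and> card A = k \<and> generate G A = carrier G)"

(* The length of ms is not required to be group_rank G: it is so automatically. *)

definition has_type :: "('a, 'b) monoid_scheme \<Rightarrow> nat list \<Rightarrow> bool" where
  "has_type G ms \<longleftrightarrow>
     (\<forall>m \<in> set ms. 1 < m) \<and>
     (\<forall>i. Suc i < length ms \<longrightarrow> ms ! i dvd ms ! Suc i) \<and>
     G \<cong> product_group {..<length ms} (\<lambda>i. integer_mod_group (ms ! i))"

end

theory Submission
  imports Defs
begin

text \<open>
  Upper bounds: let \<open>(p\<^sub>1, ..., p\<^sub>n)\<close> be a Hamiltonian cycle of a subgroup \<open>H\<close> and let \<open>e\<close> be a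
  further element. The path \<open>Q\<^sub>l = (p\<^sub>1 + l e, p\<^sub>2 - l e, p\<^sub>3 + l e, ...)\<close> has the same inner sums as
  the original one. A cycle of \<open>\<langle>H, e\<rangle>\<close> is obtained by concatenating paths \<open>Q\<^sub>l\<close>, where \<open>l\<close> runs over
  the residues modulo the order \<open>q\<close> of \<open>e\<close> modulo \<open>H\<close>. The sum at the joint of \<open>Q\<^sub>l\<close> and \<open>Q\<^sub>k\<close> is
  \<open>p\<^sub>n + p\<^sub>1 + (k - l) e\<close> if \<open>n\<close> is even, so \<open>l = 0, 1, ..., q - 1\<close> costs one new sum when \<open>q e = 0\<close>; it
  is \<open>p\<^sub>n + p\<^sub>1 + (k + l) e\<close> if \<open>n\<close> is odd, and for odd \<open>q\<close> two new sums suffice.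

  Lower bounds: \<open>x\<^bsub>i+2\<^esub> - x\<^sub>i\<close> is a difference of two sums, so the subgroup \<open>H\<close> generated by the
  differences \<open>s - s\<^sub>0\<close> has index at most two, and it needs fewer generators than there are sums. If \<open>m\<^sub>1 > 2\<close>, counting \<open>m\<^sub>1\<close>-torsion gives \<open>m\<^sub>1\<^sup>r \<le> 2 |H[m\<^sub>1]| \<le> 2 m\<^sub>1\<^sup>k\<close> when \<open>k\<close> elements generate \<open>H\<close>,
  hence \<open>r \<le> k\<close>.
\<close>

section \<open>Sums along open paths, and around cycles made of blocks\<close>

fun path_sums :: "('a, 'b) monoid_scheme \<Rightarrow> 'a list \<Rightarrow> 'a set" where
  "path_sums G (x # y # zs) = insert (x \<otimes>\<^bsub>G\<^esub> y) (path_sums G (y # zs))"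
| "path_sums G _ = {}"

lemma path_sums_append:
  assumes "xs \<noteq> []" "ys \<noteq> []"
  shows "path_sums G (xs @ ys) =
    insert (last xs \<otimes>\<^bsub>G\<^esub> hd ys) (path_sums G xs \<union> path_sums G ys)"
  using assms
proof (induction xs)
  case (Cons x xs)
  show ?case
  proof (cases xs)
    case Nil
    with Cons.prems(2) show ?thesis by (cases ys) auto
  next
    case (Cons y zs)
    with Cons.IH Cons.prems show ?thesis by auto
  qed
qed simp

lemma path_sums_conv_nth:
  "path_sums G xs = {xs ! i \<otimes>\<^bsub>G\<^esub> xs ! Suc i | i. Suc i < length xs}"
proof (induction xs rule: induct_list012)
  case (3 x y zs)
  have "{(x # y # zs) ! i \<otimes>\<^bsub>G\<^esub> (x # y # zs) ! Suc i | i. Suc i < length (x # y # zs)}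
      = insert (x \<otimes>\<^bsub>G\<^esub> y)
          {(y # zs) ! i \<otimes>\<^bsub>G\<^esub> (y # zs) ! Suc i | i. Suc i < length (y # zs)}"
    (is "?L = insert _ ?R")
  proof (intro equalityI subsetI)
    fix z assume "z \<in> ?L"
    then obtain i where i: "z = (x # y # zs) ! i \<otimes>\<^bsub>G\<^esub> (x # y # zs) ! Suc i"
      "Suc i < length (x # y # zs)" by blast
    show "z \<in> insert (x \<otimes>\<^bsub>G\<^esub> y) ?R"
      using i by (cases i) auto
  next
    fix z assume "z \<in> insert (x \<otimes>\<^bsub>G\<^esub> y) ?R"
    then consider "z = x \<otimes>\<^bsub>G\<^esub> y" | i where "z = (y # zs) ! i \<otimes>\<^bsub>G\<^esub> (y # zs) ! Suc i"
      "Suc i < length (y # zs)" by blast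
    then show "z \<in> ?L"
    proof cases
      case 1
      then show ?thesis by (auto intro!: exI[of _ 0])
    next
      case 2
      then show ?thesis by (auto intro!: exI[of _ "Suc i"])
    qed
  qed
  with 3 show ?case by (simp del: nth_Cons_Suc)
qed auto

text \<open>The closing sum is kept apart from the path sums because every block of a blowup retains
  the latter, while the former gives way to the sums at the joints between blocks.\<close>

lemma consecutive_sums_conv_path_sums:
  assumes "C \<noteq> []"
  shows "consecutive_sums G C = insert (last C \<otimes>\<^bsub>G\<^esub> hd C) (path_sums G C)"
proof -
  have "consecutive_sums G C = path_sums G (C @ [hd C])"
    unfolding consecutive_sums_def path_sums_conv_nth
  proof (intro Collect_cong ex_cong1 rev_conj_cong)
    fix z i
    show "i < length C \<longleftrightarrow> Suc i < length (C @ [hd C])" by simp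
    assume i: "Suc i < length (C @ [hd C])"
    have "C ! (Suc i mod length C) = (C @ [hd C]) ! Suc i"
    proof (cases "Suc i = length C")
      case True
      then show ?thesis using assms by (simp add: hd_conv_nth nth_append)
    next
      case False
      then show ?thesis using i by (simp add: nth_append)
    qed
    then show "z = C ! i \<otimes>\<^bsub>G\<^esub> C ! (Suc i mod length C) \<longleftrightarrow>
      z = (C @ [hd C]) ! i \<otimes>\<^bsub>G\<^esub> (C @ [hd C]) ! Suc i"
      using i by (simp add: nth_append)
  qed
  also have "\<dots> = insert (last C \<otimes>\<^bsub>G\<^esub> hd C) (path_sums G C)"
    using assms by (simp add: path_sums_append)
  finally show ?thesis .
qed

lemma last_concat_upt:
  assumes "Q k \<noteq> []"
  shows "last (concat (map Q [0..<Suc k])) = last (Q k)"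
  using assms by simp

lemma hd_concat_upt:
  assumes "Q 0 \<noteq> []"
  shows "hd (concat (map Q [0..<Suc k])) = hd (Q 0)"
  using assms by (simp add: upt_conv_Cons del: upt_Suc)

lemma consecutive_sums_concat:
  assumes "q > 0" "\<And>i. i < q \<Longrightarrow> Q i \<noteq> []" "\<And>i. i < q \<Longrightarrow> path_sums G (Q i) \<subseteq> P"
    and "\<And>i. i < q \<Longrightarrow> last (Q i) \<otimes>\<^bsub>G\<^esub> hd (Q (Suc i mod q)) \<in> B"
  shows "consecutive_sums G (concat (map Q [0..<q])) \<subseteq> P \<union> B"
proof -
  \<comment> \<open>The induction covers the open path only. The joint from the last block back to
    the first is the case \<open>i = q - 1\<close> of the last assumption and is added at the
    end.\<close>
  have *: "path_sums G (concat (map Q [0..<Suc k])) \<subseteq> P \<union> B" if "k < q" for k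
    using that
  proof (induction k)
    case 0
    then show ?case using assms(3)[of 0] by auto
  next
    case (Suc k)
    have ne: "concat (map Q [0..<Suc k]) \<noteq> []" using assms(2)[of k] Suc.prems by simp
    have "path_sums G (concat (map Q [0..<Suc (Suc k)])) =
      path_sums G (concat (map Q [0..<Suc k]) @ Q (Suc k))" by simp
    also have "\<dots> = insert (last (Q k) \<otimes>\<^bsub>G\<^esub> hd (Q (Suc k)))
       (path_sums G (concat (map Q [0..<Suc k])) \<union> path_sums G (Q (Suc k)))"
      using ne assms(2)[of "Suc k"] assms(2)[of k] Suc.prems
      by (subst path_sums_append) (simp_all add: last_concat_upt del: upt_Suc)
    finally show ?case
      using Suc assms(3)[of "Suc k"] assms(4)[of k] by auto
  qed
  obtain k where k: "q = Suc k" using assms(1) gr0_implies_Suc by blast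
  have ne: "concat (map Q [0..<q]) \<noteq> []" using assms(2)[of k] k by simp
  show ?thesis
    unfolding consecutive_sums_conv_path_sums[OF ne]
    using *[of k] assms(4)[of k] assms(2)[of k] assms(2)[of 0] k
    by (simp add: last_concat_upt hd_concat_upt del: upt_Suc)
qed

section \<open>Twisted copies of a path and their concatenation\<close>

text \<open>Consecutive entries are twisted by opposite powers of \<open>e\<close>, so the sums inside the path do not change.\<close>

primrec twist :: "('a, 'b) monoid_scheme \<Rightarrow> 'a \<Rightarrow> int \<Rightarrow> 'a list \<Rightarrow> 'a list" where
  "twist G e l [] = []"
| "twist G e l (x # xs) = (x \<otimes>\<^bsub>G\<^esub> e [^]\<^bsub>G\<^esub> l) # twist G e (- l) xs"

lemma length_twist [simp]: "length (twist G e l C) = length C"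
  by (induction C arbitrary: l) auto

lemma twist_eq_Nil [simp]: "twist G e l C = [] \<longleftrightarrow> C = []"
  using length_twist[of G e l C] by (metis length_0_conv)

lemma twist_nth:
  "k < length C \<Longrightarrow> twist G e l C ! k = C ! k \<otimes>\<^bsub>G\<^esub> e [^]\<^bsub>G\<^esub> ((-1) ^ k * l)"
  by (induction C arbitrary: l k) (auto simp: nth_Cons split: nat.splits)

lemma hd_twist: "C \<noteq> [] \<Longrightarrow> hd (twist G e l C) = hd C \<otimes>\<^bsub>G\<^esub> e [^]\<^bsub>G\<^esub> l"
  by (cases C) auto

lemma last_twist:
  "C \<noteq> [] \<Longrightarrow> last (twist G e l C) = last C \<otimes>\<^bsub>G\<^esub> e [^]\<^bsub>G\<^esub> ((-1) ^ (length C - 1) * l)"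
  by (simp add: last_conv_nth twist_nth)

text \<open>Up to the sign alternating along a block, \<open>f\<close> is the order in which the
  powers of \<open>e\<close> are visited. All constructions below differ only in the choice of
  \<open>f\<close>, which decides the sums at the joints.\<close>

definition blowup :: "('a, 'b) monoid_scheme \<Rightarrow> 'a \<Rightarrow> (nat \<Rightarrow> int) \<Rightarrow> nat \<Rightarrow> 'a list \<Rightarrow> 'a list" where
  "blowup G e f q C = concat (map (\<lambda>i. twist G e (f i) C) [0..<q])"

lemma length_blowup: "length (blowup G e f q C) = q * length C"
  by (induction q) (auto simp: blowup_def)

context comm_group
begin

lemma mult_pow_mult_pow:
  assumes "x \<in> carrier G" "y \<in> carrier G" "e \<in> carrier G"
  shows "(x \<otimes> e [^] (k::int)) \<otimes> (y \<otimes> e [^] (l::int)) = (x \<otimes> y) \<otimes> e [^] (k + l)"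
proof -
  have "(x \<otimes> e [^] k) \<otimes> (y \<otimes> e [^] l) = (x \<otimes> y) \<otimes> (e [^] k \<otimes> e [^] l)"
    using assms by (simp add: m_ac)
  then show ?thesis using assms by (simp add: int_pow_mult)
qed

lemma path_sums_twist:
  assumes "set C \<subseteq> carrier G" "e \<in> carrier G"
  shows "path_sums G (twist G e l C) = path_sums G C"
  using assms
proof (induction C arbitrary: l rule: induct_list012)
  case (3 x y zs)
  have "path_sums G (twist G e (- l) (y # zs)) = path_sums G (y # zs)"
    by (rule "3.IH"(2)) (use "3.prems" in auto)
  with 3 show ?case by (simp add: mult_pow_mult_pow)
qed auto

text \<open>The sign \<open>(-1) ^ (length C - 1)\<close> is the one carried by the last entry of a
  block. Exponents of neighbouring blocks are therefore subtracted if \<open>C\<close> has even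
  length and added if it has odd length.\<close>

lemma consecutive_sums_blowup:
  assumes "set C \<subseteq> carrier G" "C \<noteq> []" "e \<in> carrier G" "q > 0"
    and D: "\<And>i. i < q \<Longrightarrow>
      e [^] ((-1) ^ (length C - 1) * f i + f (Suc i mod q)) \<in> D"
  shows "consecutive_sums G (blowup G e f q C) \<subseteq>
    path_sums G C \<union> (\<lambda>d. last C \<otimes> hd C \<otimes> d) ` D"
  unfolding blowup_def
proof (rule consecutive_sums_concat)
  fix i assume "i < q"
  have "last C \<in> carrier G" "hd C \<in> carrier G"
    using assms(1,2) by auto
  then show "last (twist G e (f i) C) \<otimes> hd (twist G e (f (Suc i mod q)) C)
      \<in> (\<lambda>d. last C \<otimes> hd C \<otimes> d) ` D"
    using D[OF \<open>i < q\<close>] assms(2,3) by (simp add: hd_twist last_twist mult_pow_mult_pow)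
qed (use assms in \<open>auto simp: path_sums_twist\<close>)

lemma set_blowup_subset:
  assumes "y \<in> set (blowup G e f q C)"
  obtains x l where "x \<in> set C" "y = x \<otimes> e [^] (l::int)"
proof -
  from assms obtain i where "y \<in> set (twist G e (f i) C)"
    unfolding blowup_def by auto
  then obtain k where "k < length C" "y = twist G e (f i) C ! k"
    by (auto simp: in_set_conv_nth)
  then show thesis using that by (metis nth_mem twist_nth)
qed

text \<open>An entry at an odd position receives the negated exponent, and the parity of the
  position of \<open>x\<close> is not known. Hence both \<open>l\<close> and \<open>- l\<close> have
  to be represented by values of \<open>f\<close>.\<close>

lemma in_set_blowupI:
  assumes "x \<in> set C" "i < q" "e [^] f i = e [^] l" "j < q" "e [^] f j = e [^] (- l)"
    and "e \<in> carrier G"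
  shows "x \<otimes> e [^] (l::int) \<in> set (blowup G e f q C)"
proof -
  obtain k where k: "k < length C" "C ! k = x" using assms(1) by (auto simp: in_set_conv_nth)
  obtain m where m: "m < q" "e [^] ((-1) ^ k * f m) = e [^] l"
  proof (cases "even k")
    case True
    then show ?thesis using that[of i] assms by simp
  next
    case False
    then show ?thesis using that[of j] assms by (simp add: int_pow_neg)
  qed
  then have "x \<otimes> e [^] l = twist G e (f m) C ! k" using k by (simp add: twist_nth)
  then have "x \<otimes> e [^] l \<in> set (twist G e (f m) C)" using k by simp
  then show ?thesis using m(1) unfolding blowup_def by auto
qed

lemma generate_insert:
  assumes "A \<subseteq> carrier G" "e \<in> carrier G"
  shows "generate G (insert e A) = {h \<otimes> e [^] (l::int) | h l. h \<in> generate G A}"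
    (is "_ = ?R")
proof (rule equalityI)
  have sub: "subgroup (generate G A) G" using generate_is_subgroup[OF assms(1)] .
  have "subgroup ?R G"
  proof (rule subgroupI)
    show "?R \<subseteq> carrier G"
      using subgroup.subset[OF sub] assms(2) by auto
    show "?R \<noteq> {}" using generate.one by blast
  next
    fix a assume "a \<in> ?R"
    then obtain h l where a: "a = h \<otimes> e [^] (l::int)" "h \<in> generate G A" by blast
    then have "inv a = inv h \<otimes> e [^] (- l)"
      using subgroup.mem_carrier[OF sub] assms(2) by (simp add: inv_mult int_pow_neg)
    then show "inv a \<in> ?R" using subgroup.m_inv_closed[OF sub a(2)] by blast
  next
    fix a b assume "a \<in> ?R" "b \<in> ?R"
    then obtain h l h' l' where ab: "a = h \<otimes> e [^] (l::int)" "h \<in> generate G A"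
      "b = h' \<otimes> e [^] (l'::int)" "h' \<in> generate G A" by blast
    then have "a \<otimes> b = (h \<otimes> h') \<otimes> e [^] (l + l')"
      using subgroup.mem_carrier[OF sub] assms(2) by (simp add: mult_pow_mult_pow)
    then show "a \<otimes> b \<in> ?R" using subgroup.m_closed[OF sub ab(2,4)] by blast
  qed
  moreover have "insert e A \<subseteq> ?R"
  proof -
    have "e = \<one> \<otimes> e [^] (1::int)" using assms(2) by simp
    then have "e \<in> ?R" using generate.one by blast
    moreover have "a = a \<otimes> e [^] (0::int)" if "a \<in> A" for a using that assms(1) by auto
    then have "A \<subseteq> ?R" using generate.incl[of _ A G] by blast
    ultimately show ?thesis by blast
  qed
  ultimately show "generate G (insert e A) \<subseteq> ?R" by (rule generate_subgroup_incl[rotated])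
next
  have sub: "subgroup (generate G (insert e A)) G"
    using assms by (intro generate_is_subgroup) auto
  have "generate G A \<subseteq> generate G (insert e A)" by (rule mono_generate) auto
  moreover have "e [^] (l::int) \<in> generate G (insert e A)" for l
    by (intro subgroup_int_pow_closed[OF sub] generate.incl) simp
  ultimately show "?R \<subseteq> generate G (insert e A)"
    using subgroup.m_closed[OF sub] by auto
qed

lemma int_pow_eq_if_dvd:
  assumes "e \<in> carrier G" "e [^] (q::nat) = \<one>" "int q dvd k - l"
  shows "e [^] k = e [^] l"
proof -
  obtain c where c: "k = l + int q * c" using assms(3) by (metis dvd_def diff_add_cancel add.commute)
  have "e [^] (int q * c) = \<one>"
    using assms(1,2) by (simp add: int_pow_int flip: int_pow_pow)
  then show ?thesis unfolding c int_pow_mult[OF assms(1)] using assms(1) by simp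
qed

section \<open>Upper bounds: construction of cycles\<close>

text \<open>Blowing up the one-entry list \<open>[\<one>]\<close> with exponents 0, 1, -2, 3, -4,
  ... makes neighbours add up to 1 and -1 alternately. As \<open>m\<close> is even, the closing
  exponent \<open>m - 1\<close> is -1 modulo \<open>m\<close>. Since \<open>m\<close> is not assumed
  to be the order of \<open>e\<close>, the length is recorded instead of distinctness, which is
  recovered later by counting.\<close>

lemma cyclic_even_cycle:
  assumes "e \<in> carrier G" "even m" "m > 0" "e [^] m = \<one>"
  obtains C where "length C = m" "set C = generate G {e}" "consecutive_sums G C \<subseteq> {e, inv e}"
proof
  define f :: "nat \<Rightarrow> int" where "f i = (-1) ^ Suc i * int i" for i
  define C where "C = blowup G e f m [\<one>]"
  show "length C = m" by (simp add: C_def length_blowup)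
  have ex: "\<exists>i<m. e [^] f i = e [^] l" for l :: int
  proof -
    \<comment> \<open>Index \<open>i\<close> contributes \<open>- i\<close> if it is even and
      \<open>i\<close> if it is odd. So an even \<open>l\<close> is found at the residue of
      \<open>- l\<close> and an odd one at the residue of \<open>l\<close>; reduction modulo the
      even \<open>m\<close> keeps the parity.\<close>
    define i where "i = nat ((if even l then - l else l) mod int m)"
    have i: "int i = (if even l then - l else l) mod int m" using assms(3) by (simp add: i_def)
    have "i < m" using assms(3) by (simp add: i_def nat_less_iff)
    have dv: "int m dvd int i - (if even l then - l else l)"
      unfolding i by (simp add: mod_eq_dvd_iff[symmetric])
    have "even (int m)" using assms(2) by simp
    with dv have "even (int i - (if even l then - l else l))" by (rule dvd_trans[rotated])
    then have par: "even i \<longleftrightarrow> even l" by (auto split: if_splits)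
    have "int m dvd f i - l"
    proof (cases "even l")
      case True
      then have "f i - l = - (int i - - l)" using par by (simp add: f_def)
      then show ?thesis using dv True by (metis dvd_minus_iff)
    next
      case False
      then show ?thesis using dv par by (simp add: f_def)
    qed
    then show ?thesis using \<open>i < m\<close> int_pow_eq_if_dvd[OF assms(1,4)] by blast
  qed
  have "set C = {h \<otimes> e [^] (l::int) | h l. h \<in> {\<one>}}"
  proof (intro equalityI subsetI)
    fix y assume "y \<in> set C"
    then obtain x l where "x \<in> set [\<one>]" "y = x \<otimes> e [^] (l::int)"
      unfolding C_def by (rule set_blowup_subset)
    then show "y \<in> {h \<otimes> e [^] (l::int) | h l. h \<in> {\<one>}}" by auto
  next
    fix y assume "y \<in> {h \<otimes> e [^] (l::int) | h l. h \<in> {\<one>}}"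
    then obtain l where l: "y = \<one> \<otimes> e [^] (l::int)" by auto
    obtain i j where "i < m" "e [^] f i = e [^] l" "j < m" "e [^] f j = e [^] (- l)"
      using ex[of l] ex[of "-l"] by auto
    then show "y \<in> set C" unfolding C_def l using assms(1) by (intro in_set_blowupI) auto
  qed
  then show "set C = generate G {e}" using generate_insert[of "{}" e] assms(1) by (simp add: generate_empty)
  have "consecutive_sums G C \<subseteq> path_sums G [\<one>] \<union> (\<lambda>d. last [\<one>] \<otimes> hd [\<one>] \<otimes> d) ` {e, inv e}"
    unfolding C_def
  proof (rule consecutive_sums_blowup)
    fix i assume i: "i < m"
    show "e [^] ((-1) ^ (length [\<one>] - 1) * f i + f (Suc i mod m)) \<in> {e, inv e}"
    proof (cases "even i")
      case True
      \<comment> \<open>The closing joint has the odd index \<open>m - 1\<close>, so here no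
        wrap-around occurs.\<close>
      then have "Suc i \<noteq> m" using assms(2) by auto
      with i True show ?thesis using assms(1) by (simp add: f_def)
    next
      case False
      have "int m dvd f i + f (Suc i mod m) - (- 1)"
        using i False by (cases "Suc i = m") (auto simp: f_def add.commute)
      then have "e [^] (f i + f (Suc i mod m)) = e [^] (- 1 :: int)"
        by (rule int_pow_eq_if_dvd[OF assms(1,4)])
      then show ?thesis using assms(1) by (simp add: int_pow_neg)
    qed
  qed (use assms in auto)
  then show "consecutive_sums G C \<subseteq> {e, inv e}" using assms(1) by auto
qed

text \<open>For even length the joints see differences of exponents, so visiting 0, 1, ...,
  \<open>q - 1\<close> in order gives exponent 1 everywhere; at the closing joint the difference is
  \<open>1 - q\<close>, which is harmless because \<open>e [^] q = \<one>\<close>.\<close>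

lemma even_cycle_extend:
  assumes "A \<subseteq> carrier G" "e \<in> carrier G" "q > 0" "e [^] q = \<one>"
    and "set C = generate G A" "even (length C)"
  obtains C' s where "length C' = q * length C" "set C' = generate G (insert e A)"
    "consecutive_sums G C' \<subseteq> insert s (consecutive_sums G C)"
proof
  define C' where "C' = blowup G e int q C"
  have ne: "C \<noteq> []" using assms(5) generate.one[of G A] by auto
  have car: "set C \<subseteq> carrier G" using assms(5) generate_incl[OF assms(1)] by simp
  show "length C' = q * length C" by (simp add: C'_def length_blowup)
  have ex: "\<exists>i<q. e [^] int i = e [^] l" for l :: int
  proof -
    have "int q dvd int (nat (l mod int q)) - l"
      using assms(3) by (simp add: mod_eq_dvd_iff[symmetric])
    then have "e [^] int (nat (l mod int q)) = e [^] l"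
      by (rule int_pow_eq_if_dvd[OF assms(2,4)])
    moreover have "nat (l mod int q) < q" using assms(3) by (simp add: nat_less_iff)
    ultimately show ?thesis by blast
  qed
  show "set C' = generate G (insert e A)"
    unfolding generate_insert[OF assms(1,2)] assms(5)[symmetric]
  proof (intro equalityI subsetI)
    fix y assume "y \<in> set C'"
    then show "y \<in> {h \<otimes> e [^] (l::int) | h l. h \<in> set C}"
      unfolding C'_def by (rule set_blowup_subset) blast
  next
    fix y assume "y \<in> {h \<otimes> e [^] (l::int) | h l. h \<in> set C}"
    then obtain h l where l: "y = h \<otimes> e [^] (l::int)" "h \<in> set C" by auto
    obtain i j where "i < q" "e [^] int i = e [^] l" "j < q" "e [^] int j = e [^] (- l)"
      using ex[of l] ex[of "-l"] by auto
    then show "y \<in> set C'" unfolding C'_def l(1) using assms(2) l(2) by (intro in_set_blowupI)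
  qed
  have "consecutive_sums G C' \<subseteq> path_sums G C \<union> (\<lambda>d. last C \<otimes> hd C \<otimes> d) ` {e}"
    unfolding C'_def
  proof (rule consecutive_sums_blowup)
    fix i assume i: "i < q"
    have "odd (length C - 1)" using ne assms(6) by (cases C) auto
    moreover have "int q dvd - int i + int (Suc i mod q) - 1"
    proof (cases "Suc i = q")
      case True
      then have "- int i + int (Suc i mod q) - 1 = - int q" by auto
      then show ?thesis by simp
    qed (use i in auto)
    then have "e [^] (- int i + int (Suc i mod q)) = e [^] (1::int)"
      by (rule int_pow_eq_if_dvd[OF assms(2,4)])
    ultimately show "e [^] ((-1) ^ (length C - 1) * int i + int (Suc i mod q)) \<in> {e}"
      using assms(2) by simp
  qed (use assms ne car in auto)
  then show "consecutive_sums G C' \<subseteq> insert (last C \<otimes> hd C \<otimes> e) (consecutive_sums G C)"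
    unfolding consecutive_sums_conv_path_sums[OF ne] by auto
qed

text \<open>This \<open>q\<close> is the order of the coset of \<open>e\<close> in the quotient by
  \<open>H\<close>: the least positive exponent that sends \<open>e\<close> into \<open>H\<close>.
  Division with remainder shows that all other such exponents are multiples of it.\<close>

lemma subgroup_relative_order:
  assumes "finite (carrier G)" "subgroup H G" "e \<in> carrier G"
  obtains q where "q > 0" "\<forall>l::int. e [^] l \<in> H \<longleftrightarrow> int q dvd l"
proof -
  define q where "q = (LEAST n. n > 0 \<and> e [^] int n \<in> H)"
  have "e [^] int (order G) \<in> H"
    using assms pow_order_eq_1[OF assms(3)] subgroup.one_closed[OF assms(2)] by (simp add: int_pow_int)
  moreover have "order G > 0" using assms(1) by (simp add: order_gt_0_iff_finite)
  ultimately have q: "q > 0 \<and> e [^] int q \<in> H"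
    unfolding q_def using LeastI[of "\<lambda>n. n > 0 \<and> e [^] int n \<in> H" "order G"] by blast
  have "e [^] l \<in> H \<longleftrightarrow> int q dvd l" for l :: int
  proof
    assume "int q dvd l"
    then obtain c where "l = int q * c" by blast
    then show "e [^] l \<in> H"
      using subgroup_int_pow_closed[OF assms(2) conjunct2[OF q], of c] assms(3)
      by (simp add: int_pow_pow)
  next
    assume l: "e [^] l \<in> H"
    have "l mod int q = l + int q * (- (l div int q))"
      by (simp add: minus_div_mult_eq_mod[symmetric] algebra_simps)
    then have "e [^] (l mod int q) = e [^] l \<otimes> (e [^] int q) [^] (- (l div int q))"
      using assms(3) by (simp only: int_pow_mult int_pow_pow)
    then have "e [^] (l mod int q) \<in> H"
      using subgroup.m_closed[OF assms(2) l] subgroup_int_pow_closed[OF assms(2) conjunct2[OF q]]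
      by simp
    then have "e [^] int (nat (l mod int q)) \<in> H" using q by simp
    moreover have "nat (l mod int q) < q" using q by (simp add: nat_less_iff)
    ultimately have "nat (l mod int q) = 0"
      using not_less_Least[of "nat (l mod int q)" "\<lambda>n. n > 0 \<and> e [^] int n \<in> H"]
      unfolding q_def[symmetric] by auto
    moreover have "l mod int q \<ge> 0" using q by simp
    ultimately show "int q dvd l" by (simp add: dvd_eq_mod_eq_0)
  qed
  with q that[of q] show thesis by blast
qed

text \<open>Here \<open>e\<close> is an arbitrary generator, so \<open>e [^] q\<close> lies in
  \<open>set C\<close> but may differ from \<open>\<one>\<close>. The exponents at the joints must
  therefore be 0, 1 or -1 as integers, not merely modulo \<open>q\<close>. Exponent 0 costs nothing,
  as it reproduces the closing sum of \<open>C\<close>.\<close>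

lemma odd_cycle_extend:
  assumes "finite (carrier G)" "odd (order G)" "A \<subseteq> carrier G" "e \<in> carrier G"
    and "distinct C" "set C = generate G A"
  obtains C' s t where "distinct C'" "set C' = generate G (insert e A)"
    "consecutive_sums G C' \<subseteq> {s, t} \<union> consecutive_sums G C"
proof -
  have sub: "subgroup (set C) G" using assms(3,6) by (simp add: generate_is_subgroup)
  obtain q where q: "q > 0" "\<forall>l::int. e [^] l \<in> set C \<longleftrightarrow> int q dvd l"
    using subgroup_relative_order[OF assms(1) sub assms(4)] .
  have "e [^] int (order G) \<in> set C"
    using assms(4) pow_order_eq_1 subgroup.one_closed[OF sub] by (simp add: int_pow_int)
  then have "q dvd order G" using q(2) by simp
  with assms(2) have oq: "odd q" by auto
  have "length C dvd order G"
    using lagrange[OF sub] distinct_card[OF assms(5)] by (metis dvd_triv_right)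
  with assms(2) have oC: "odd (length C)" by auto
  have ne: "C \<noteq> []" using oC by auto
  have car: "set C \<subseteq> carrier G" using subgroup.subset[OF sub] .
  \<comment> \<open>\<open>0, 1, -2, 3, ..., -3, 2, -1\<close>: every residue modulo \<open>q\<close> once, neighbours adding up to \<open>0\<close> or \<open>\<plusminus>1\<close>.\<close>
  define f :: "nat \<Rightarrow> int" where "f i = (-1) ^ Suc i * int (min i (q - i))" for i
  define C' where "C' = blowup G e f q C"
  have f_surj: "\<exists>i<q. f i = b" if "\<bar>b\<bar> * 2 < int q" for b
  proof -
    obtain j where jb: "int j = \<bar>b\<bar>" using zero_le_imp_eq_int[of "\<bar>b\<bar>"] by auto
    then have j: "2 * j < q" using that by linarith
    show ?thesis
    \<comment> \<open>A nonzero value of modulus \<open>j\<close> can occur at the indices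
      \<open>j\<close> and \<open>q - j\<close>. As \<open>q\<close> is odd, these have opposite
      parity, so one carries each sign.\<close>
    proof (cases "b = 0 \<or> (b > 0 \<longleftrightarrow> odd j)")
      case True
      have "f j = (if odd j then int j else - int j)"
        using j by (simp add: f_def min_def)
      with True have "f j = b" using jb by (auto split: if_splits)
      then show ?thesis using j by (intro exI[of _ j]) auto
    next
      case False
      then have "j > 0" using jb by auto
      have "even (q - j) \<longleftrightarrow> odd j" using oq j by (simp add: even_diff_nat)
      moreover have "min (q - j) (q - (q - j)) = j" using j by simp
      ultimately have "f (q - j) = (if even j then int j else - int j)"
        unfolding f_def by (simp del: even_diff_nat)
      with False have "f (q - j) = b" using jb by (auto split: if_splits)
      then show ?thesis using j \<open>j > 0\<close> by (intro exI[of _ "q - j"]) auto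
    qed
  qed
  have set_C': "set C' = generate G (insert e A)"
    unfolding generate_insert[OF assms(3,4)] assms(6)[symmetric]
  proof (intro equalityI subsetI)
    fix y assume "y \<in> set C'"
    then show "y \<in> {h \<otimes> e [^] (l::int) | h l. h \<in> set C}"
      unfolding C'_def by (rule set_blowup_subset) blast
  next
    fix y assume "y \<in> {h \<otimes> e [^] (l::int) | h l. h \<in> set C}"
    then obtain h l where l: "y = h \<otimes> e [^] (l::int)" "h \<in> set C" by auto
    \<comment> \<open>With \<open>q = 2 * m + 1\<close>, \<open>b\<close> is the residue of
      \<open>l\<close> in the symmetric range from \<open>- m\<close> to \<open>m\<close>. The
      remaining factor \<open>e [^] (int q * c)\<close> lies in \<open>set C\<close> and is absorbed
      into \<open>h\<close>.\<close>
    define m where "m = int (q div 2)"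
    define r where "r = (l + m) mod int q"
    define b where "b = r - m"
    define c where "c = (l + m) div int q"
    have lb: "l = int q * c + b" unfolding b_def c_def r_def by (simp add: algebra_simps)
    have qm: "int q = 2 * m + 1" using oq unfolding m_def by (auto elim!: oddE)
    have "0 \<le> r" "r < int q" using q(1) by (auto simp: r_def)
    then have "b \<le> m" "- m \<le> b" using qm unfolding b_def by linarith+
    then have "\<bar>b\<bar> * 2 < int q" using qm by (simp add: abs_le_iff)
    then obtain i j where ij: "i < q" "f i = b" "j < q" "f j = - b"
      using f_surj[of b] f_surj[of "-b"] by auto
    have "h \<otimes> e [^] (int q * c) \<in> set C"
      using subgroup.m_closed[OF sub l(2)] q(2) by simp
    then have "(h \<otimes> e [^] (int q * c)) \<otimes> e [^] b \<in> set (blowup G e f q C)"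
      using ij assms(4) by (intro in_set_blowupI[where i = i and j = j]) auto
    moreover have "y = (h \<otimes> e [^] (int q * c)) \<otimes> e [^] b"
      unfolding l(1) lb using l(2) car assms(4) by (auto simp: int_pow_mult m_assoc)
    ultimately show "y \<in> set C'" unfolding C'_def by simp
  qed
  \<comment> \<open>Distinctness follows by counting: these products are \<open>q * length C\<close>
    different elements of \<open>set C'\<close>, and \<open>C'\<close> has exactly that
    length.\<close>
  have "inj_on (\<lambda>(h, l). h \<otimes> e [^] int l) (set C \<times> {..<q})"
  proof (rule inj_onI, clarify)
    fix h l h' l'
    assume h: "h \<in> set C" "h' \<in> set C" and l: "l < q" "l' < q"
      and eq: "h \<otimes> e [^] int l = h' \<otimes> e [^] int l'"
    have hc: "h \<in> carrier G" "h' \<in> carrier G" using h car by auto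
    have "e [^] (int l - int l') = inv h \<otimes> (h \<otimes> e [^] int l) \<otimes> inv (e [^] int l')"
      using hc assms(4) by (simp add: int_pow_diff m_assoc[symmetric])
    also have "\<dots> = inv h \<otimes> h'"
      unfolding eq using hc assms(4) by (simp add: m_assoc)
    finally have "int q dvd int l - int l'"
      using q(2) subgroup.m_closed[OF sub] subgroup.m_inv_closed[OF sub] h by metis
    moreover have "\<bar>int l - int l'\<bar> < int q" using l by linarith
    ultimately have "l = l'" using dvd_imp_le_int[of "int l - int l'" "int q"] by fastforce
    with eq hc assms(4) show "h = h' \<and> l = l'" by simp
  qed
  then have "card ((\<lambda>(h, l). h \<otimes> e [^] int l) ` (set C \<times> {..<q})) = length C'"
    using distinct_card[OF assms(5)]
    by (simp add: card_image card_cartesian_product C'_def length_blowup)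
  moreover have "(\<lambda>(h, l). h \<otimes> e [^] int l) ` (set C \<times> {..<q}) \<subseteq> set C'"
    unfolding set_C' generate_insert[OF assms(3,4)] assms(6) by auto
  ultimately have "length C' \<le> card (set C')"
    by (metis List.finite_set card_mono)
  then have "distinct C'" by (simp add: card_distinct card_length le_antisym)
  moreover
  have "consecutive_sums G C' \<subseteq>
    path_sums G C \<union> (\<lambda>d. last C \<otimes> hd C \<otimes> d) ` {\<one>, e, inv e}"
    unfolding C'_def
  proof (rule consecutive_sums_blowup)
    fix i assume i: "i < q"
    have "even (length C - 1)" using oC by simp
    moreover have "f i + f (Suc i mod q) \<in> {0, 1, -1}"
    proof (cases "Suc i = q")
      \<comment> \<open>The closing joint adds \<open>f 0 = 0\<close> to \<open>f (q - 1)\<close>,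
        which is -1, or 0 if \<open>q = 1\<close>.\<close>
      case True
      then have "even i" using oq by auto
      then show ?thesis using True by (auto simp: f_def min_def)
    next
      case False
      then have "Suc i mod q = Suc i" using i by simp
      then show ?thesis using i False by (cases "even i") (auto simp: f_def min_def)
    qed
    ultimately show "e [^] ((-1) ^ (length C - 1) * f i + f (Suc i mod q)) \<in> {\<one>, e, inv e}"
      using assms(4) by (auto simp: int_pow_neg)
  qed (use assms(4) q ne car in auto)
  then have "consecutive_sums G C' \<subseteq>
      {last C \<otimes> hd C \<otimes> e, last C \<otimes> hd C \<otimes> inv e} \<union> consecutive_sums G C"
    unfolding consecutive_sums_conv_path_sums[OF ne] using ne car by (auto simp: subset_iff)
  ultimately show thesis using that set_C' by blast
qed

lemma consecutive_sums_subset: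
  "set C \<subseteq> carrier G \<Longrightarrow> consecutive_sums G C \<subseteq> carrier G"
  unfolding consecutive_sums_def
  by (auto simp: subset_iff)
    (metis m_closed mod_less_divisor nth_mem gr_implies_not0 length_greater_0_conv list.size(3))

lemma finite_consecutive_sums [simp]: "finite (consecutive_sums G C)"
  unfolding consecutive_sums_def by simp

lemma odd_cycle_exists:
  assumes "finite (carrier G)" "odd (order G)" "finite A" "A \<subseteq> carrier G"
  shows "\<exists>C. distinct C \<and> set C = generate G A \<and> card (consecutive_sums G C) \<le> 2 * card A + 1"
  using assms(3,4)
proof (induction rule: finite_induct)
  case empty
  show ?case
    by (rule exI[of _ "[\<one>]"]) (simp add: generate_empty consecutive_sums_conv_path_sums)
next
  case (insert e A)
  then obtain C where C: "distinct C" "set C = generate G A"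
    "card (consecutive_sums G C) \<le> 2 * card A + 1" by auto
  obtain C' s t where C': "distinct C'" "set C' = generate G (insert e A)"
    "consecutive_sums G C' \<subseteq> {s, t} \<union> consecutive_sums G C"
    using odd_cycle_extend[OF assms(1,2), of A e C] C(1,2) insert.prems by auto
  have "card (consecutive_sums G C') \<le> card ({s, t} \<union> consecutive_sums G C)"
    by (rule card_mono[OF _ C'(3)]) simp
  also have "\<dots> \<le> card {s, t} + card (consecutive_sums G C)" by (rule card_Un_le)
  also have "card {s, t} \<le> 2" by (simp add: card_insert_if)
  finally show ?case using C C' insert.hyps by (intro exI[of _ C']) simp
qed


text \<open>The index \<open>j\<close> comes first: with the even factor \<open>m j\<close> in place
  every later list has even length, as each extension requires. The start costs two sums, or one if
  \<open>m j = 2\<close> since then \<open>e j\<close> is its own inverse; every further index costs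
  one.\<close>

lemma even_cycle_exists:
  assumes "finite I" "j \<in> I" "\<And>i. i \<in> I \<Longrightarrow> e i \<in> carrier G"
    and "\<And>i. i \<in> I \<Longrightarrow> m i > 0" "\<And>i. i \<in> I \<Longrightarrow> e i [^] (m i :: nat) = \<one>" "even (m j)"
  shows "\<exists>C. length C = (\<Prod>i\<in>I. m i) \<and> set C = generate G (e ` I) \<and>
    card (consecutive_sums G C) \<le> (if m j = 2 then card I else card I + 1)"
proof -
  have "\<exists>C. length C = (\<Prod>i\<in>insert j J. m i) \<and> set C = generate G (e ` insert j J) \<and>
    card (consecutive_sums G C) \<le> card J + (if m j = 2 then 1 else 2)"
    if "finite J" "J \<subseteq> I - {j}" for J
    using that
  proof (induction rule: finite_induct)
    case empty
    obtain C where C: "length C = m j" "set C = generate G {e j}"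
      "consecutive_sums G C \<subseteq> {e j, inv (e j)}"
      using cyclic_even_cycle[of "e j" "m j"] assms by blast
    have "card (consecutive_sums G C) \<le> card {e j, inv (e j)}"
      using C(3) by (intro card_mono) auto
    also have "\<dots> \<le> (if m j = 2 then 1 else 2)"
    proof (cases "m j = 2")
      case True
      then have "e j \<otimes> e j = \<one>"
        using assms(2) assms(3,5)[of j] by (simp add: numeral_2_eq_2)
      then have "inv (e j) = e j" using assms(2,3) by (simp add: inv_equality)
      then show ?thesis using True by simp
    qed (simp add: card_insert_if)
    finally show ?case using C by (intro exI[of _ C]) simp
  next
    case (insert k J)
    then obtain C where C: "length C = (\<Prod>i\<in>insert j J. m i)" "set C = generate G (e ` insert j J)"
      "card (consecutive_sums G C) \<le> card J + (if m j = 2 then 1 else 2)" by auto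
    have "even (length C)"
      using C(1) insert.hyps insert.prems assms(6) by (subst C(1)) (auto simp: prod.insert_remove)
    moreover have "e ` insert j J \<subseteq> carrier G" "e k \<in> carrier G" "m k > 0" "e k [^] m k = \<one>"
      using insert.prems assms by auto
    ultimately obtain C' s where C': "length C' = m k * length C"
      "set C' = generate G (insert (e k) (e ` insert j J))"
      "consecutive_sums G C' \<subseteq> insert s (consecutive_sums G C)"
      using even_cycle_extend C(2) by metis
    have "length C' = (\<Prod>i\<in>insert j (insert k J). m i)"
      using C(1) C'(1) insert.hyps insert.prems by (auto simp: insert_commute[of j k])
    moreover have "set C' = generate G (e ` insert j (insert k J))"
      using C'(2) by (simp add: insert_commute[of "e k" "e j" "e ` J"])
    moreover have "card (consecutive_sums G C') \<le> Suc (card (consecutive_sums G C))"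
      using card_mono[OF _ C'(3)] by (simp add: card_insert_if split: if_splits)
    ultimately show ?case
      using C C' insert.hyps by (intro exI[of _ C']) auto
  qed
  from this[of "I - {j}"] obtain C where "length C = (\<Prod>i\<in>I. m i)" "set C = generate G (e ` I)"
    "card (consecutive_sums G C) \<le> card (I - {j}) + (if m j = 2 then 1 else 2)"
    using assms(1,2) by (auto simp: insert_absorb)
  moreover have "card I = Suc (card (I - {j}))" using assms(1,2) by (rule card.remove)
  ultimately show ?thesis by (intro exI[of _ C]) (auto split: if_splits)
qed

section \<open>Lower bounds: a subgroup of index at most two, and counting torsion\<close>

text \<open>Modulo the differences of sums all sums equal one fixed \<open>s0\<close>, so each step
  along the cycle sends \<open>x\<close> to \<open>s0 - x\<close> and the entries alternate between
  two cosets. The trivial difference of \<open>s0\<close> with itself is left out, whence the strict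
  bound on \<open>card D\<close>.\<close>

lemma carrier_almost_generated_by_differences:
  assumes "finite (carrier G)" "set C = carrier G"
  obtains D c where "finite D" "D \<subseteq> carrier G" "c \<in> carrier G"
    "card D < card (consecutive_sums G C)"
    "\<forall>x \<in> carrier G. x \<in> generate G D \<or> x \<otimes> c \<in> generate G D"
proof -
  have ne: "C \<noteq> []" using assms(2) by auto
  define S where "S = consecutive_sums G C"
  have S: "finite S" "S \<noteq> {}" unfolding S_def consecutive_sums_def using ne by auto
  have "set C \<subseteq> carrier G" using assms(2) by simp
  then have Sc: "S \<subseteq> carrier G"
    unfolding S_def by (rule consecutive_sums_subset)
  obtain s0 where s0: "s0 \<in> S" using S by blast
  then have s0c: "s0 \<in> carrier G" using Sc by blast
  define D where "D = (\<lambda>s. s \<otimes> inv s0) ` (S - {s0})"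
  define H where "H = generate G D"
  have Dc: "D \<subseteq> carrier G" using Sc s0c by (auto simp: D_def)
  have sub: "subgroup H G" unfolding H_def using Dc by (rule generate_is_subgroup)
  have diff: "s \<otimes> inv s0 \<in> H" if "s \<in> S" for s
  proof (cases "s = s0")
    case True
    then show ?thesis using s0c subgroup.one_closed[OF sub] by simp
  next
    case False
    then show ?thesis using that unfolding H_def D_def by (intro generate.incl) auto
  qed
  define x0 where "x0 = C ! 0"
  have x0: "x0 \<in> carrier G" using ne assms(2) nth_mem[of 0 C] by (simp add: x0_def)
  \<comment> \<open>Even indices stay in the coset of \<open>x0\<close>, odd ones in that of
    \<open>s0 - x0\<close>.\<close>
  have walk: "C ! i \<otimes> (if even i then inv x0 else x0 \<otimes> inv s0) \<in> H" if "i < length C" for i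
    using that
  proof (induction i)
    case 0
    then show ?case using x0 subgroup.one_closed[OF sub] by (simp add: x0_def[symmetric])
  next
    case (Suc i)
    define x where "x = C ! i"
    define y where "y = C ! Suc i"
    have xy: "x \<in> carrier G" "y \<in> carrier G"
      using Suc.prems assms(2) nth_mem unfolding x_def y_def by (metis Suc_lessD)+
    have "x \<otimes> y \<in> S"
      unfolding S_def consecutive_sums_def x_def y_def using Suc.prems
      by (auto intro!: exI[of _ i])
    then have *: "(x \<otimes> y) \<otimes> inv s0 \<in> H" by (rule diff)
    have IH: "x \<otimes> (if even i then inv x0 else x0 \<otimes> inv s0) \<in> H"
      using Suc unfolding x_def by simp
    have "y \<otimes> (if odd i then inv x0 else x0 \<otimes> inv s0) =
      ((x \<otimes> y) \<otimes> inv s0) \<otimes> inv (x \<otimes> (if even i then inv x0 else x0 \<otimes> inv s0))"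
    proof (cases "even i")
      case True
      have "((x \<otimes> y) \<otimes> inv s0) \<otimes> inv (x \<otimes> inv x0) = (x \<otimes> inv x) \<otimes> (y \<otimes> (x0 \<otimes> inv s0))"
        using xy x0 s0c by (simp add: inv_mult m_ac del: r_inv Units_r_inv)
      then show ?thesis using True xy x0 s0c by simp
    next
      case False
      have "((x \<otimes> y) \<otimes> inv s0) \<otimes> inv (x \<otimes> (x0 \<otimes> inv s0)) =
        ((x \<otimes> inv x) \<otimes> (s0 \<otimes> inv s0)) \<otimes> (y \<otimes> inv x0)"
        using xy x0 s0c by (simp add: inv_mult m_ac del: r_inv Units_r_inv)
      then show ?thesis using False xy x0 s0c by simp
    qed
    also have "\<dots> \<in> H"
      using subgroup.m_closed[OF sub *] subgroup.m_inv_closed[OF sub IH] by blast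
    finally show ?case unfolding y_def by simp
  qed
  have cover: "x \<otimes> inv x0 \<in> H \<or> x \<otimes> (x0 \<otimes> inv s0) \<in> H" if "x \<in> carrier G" for x
  proof -
    from that assms(2) obtain i where "i < length C" "C ! i = x" by (metis in_set_conv_nth)
    with walk[of i] show ?thesis by (cases "even i") auto
  qed
  have absorb: "x \<in> H" if "x \<otimes> a \<in> H" "a \<in> H" "x \<in> carrier G" for x a
  proof -
    have "x = (x \<otimes> a) \<otimes> inv a"
      using that subgroup.mem_carrier[OF sub] by (simp add: m_assoc)
    then show ?thesis using that subgroup.m_closed[OF sub] subgroup.m_inv_closed[OF sub] by metis
  qed
  \<comment> \<open>The identity lies in one of the two cosets, which is thus \<open>H\<close>
    itself. The inverse of the representative of the other coset serves as \<open>c\<close>.\<close>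
  obtain c where "c \<in> carrier G" "\<forall>x \<in> carrier G. x \<in> H \<or> x \<otimes> c \<in> H"
  proof (cases "inv x0 \<in> H")
    case True
    then show ?thesis using that[of "x0 \<otimes> inv s0"] x0 s0c cover absorb by blast
  next
    case False
    then have "x0 \<otimes> inv s0 \<in> H" using cover[OF one_closed] x0 s0c by simp
    then show ?thesis using that[of "inv x0"] x0 s0c cover absorb by blast
  qed
  moreover have "card D < card S"
  proof -
    have "card D \<le> card (S - {s0})" unfolding D_def using S by (intro card_image_le) auto
    also have "\<dots> < card S" using S s0 by (intro psubset_card_mono) auto
    finally show ?thesis .
  qed
  moreover have "finite D" using S by (simp add: D_def)
  ultimately show thesis using that Dc unfolding H_def S_def by blast
qed

text \<open>Dividing the exponent of each generator by \<open>d\<close> leaves a remainder below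
  \<open>d\<close>; the quotients are collected in the \<open>d\<close>-th power.\<close>

lemma generate_mod_powers:
  assumes "finite A" "A \<subseteq> carrier G" "(d::nat) > 0"
  shows "\<exists>T. finite T \<and> T \<subseteq> carrier G \<and> card T \<le> d ^ card A \<and>
    (\<forall>x \<in> generate G A. \<exists>t \<in> T. \<exists>y \<in> generate G A. x = t \<otimes> y [^] d)"
  using assms(1,2)
proof (induction rule: finite_induct)
  case empty
  show ?case by (rule exI[of _ "{\<one>}"]) (simp add: generate_empty)
next
  case (insert e A)
  then obtain T where T: "finite T" "T \<subseteq> carrier G" "card T \<le> d ^ card A"
    "\<forall>x \<in> generate G A. \<exists>t \<in> T. \<exists>y \<in> generate G A. x = t \<otimes> y [^] d" by auto
  have e: "e \<in> carrier G" and A: "A \<subseteq> carrier G" using insert.prems by auto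
  define T' where "T' = (\<lambda>(t, i). t \<otimes> e [^] int i) ` (T \<times> {..<d})"
  have "card T' \<le> card (T \<times> {..<d})"
    unfolding T'_def using T(1) by (intro card_image_le) auto
  also have "\<dots> \<le> d ^ card (insert e A)"
    using T(3) insert.hyps by (simp add: card_cartesian_product)
  finally have "card T' \<le> d ^ card (insert e A)" .
  moreover have "finite T'" "T' \<subseteq> carrier G" using T e by (auto simp: T'_def)
  moreover have "\<exists>t \<in> T'. \<exists>y \<in> generate G (insert e A). x = t \<otimes> y [^] d"
    if "x \<in> generate G (insert e A)" for x
  proof -
    from that obtain h l where x: "x = h \<otimes> e [^] (l::int)" "h \<in> generate G A"
      unfolding generate_insert[OF A e] by blast
    then obtain t y where ty: "t \<in> T" "y \<in> generate G A" "h = t \<otimes> y [^] d" using T(4) by blast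
    have yc: "y \<in> carrier G" using generate_in_carrier[OF A ty(2)] .
    have tc: "t \<in> carrier G" using ty(1) T(2) by blast
    define i where "i = nat (l mod int d)"
    have i: "i < d" "l = int i + l div int d * int d"
      using assms(3) by (auto simp: i_def nat_less_iff)
    have "(y \<otimes> e [^] (l div int d)) [^] d = y [^] d \<otimes> e [^] (l div int d * int d)"
      using yc e by (simp add: nat_pow_distrib int_pow_pow[symmetric] int_pow_int)
    moreover have "e [^] l = e [^] int i \<otimes> e [^] (l div int d * int d)"
      using e i(2) by (metis int_pow_mult)
    ultimately have "x = (t \<otimes> e [^] int i) \<otimes> (y \<otimes> e [^] (l div int d)) [^] d"
      unfolding x(1) ty(3) using yc tc e by (simp add: m_ac)
    moreover have "t \<otimes> e [^] int i \<in> T'" unfolding T'_def using ty(1) i(1) by auto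
    moreover have "y \<otimes> e [^] (l div int d) \<in> generate G (insert e A)"
      unfolding generate_insert[OF A e] using ty(2) by blast
    ultimately show ?thesis by blast
  qed
  ultimately show ?case by blast
qed

text \<open>The \<^term>\<open>d\<close>-torsion of \<^term>\<open>generate G A\<close> has the same size as the quotient
  by \<^term>\<open>d\<close>-th powers, and that quotient is represented by products of small powers of generators.\<close>

lemma card_torsion_generate_le:
  assumes "finite (carrier G)" "finite A" "A \<subseteq> carrier G" "(d::nat) > 0"
  shows "card {x \<in> generate G A. x [^] d = \<one>} \<le> d ^ card A"
proof -
  define H where "H = generate G A"
  define K where "K = {x \<in> H. x [^] d = \<one>}"
  define P where "P = (\<lambda>x. x [^] d) ` H"
  have sub: "subgroup H G" unfolding H_def using assms(3) by (rule generate_is_subgroup)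
  have Hc: "H \<subseteq> carrier G" using subgroup.subset[OF sub] .
  have fin: "finite H" using Hc assms(1) finite_subset by blast
  obtain T where T: "finite T" "card T \<le> d ^ card A"
    "\<forall>x \<in> H. \<exists>t \<in> T. \<exists>y \<in> H. x = t \<otimes> y [^] d"
    using generate_mod_powers[OF assms(2-4)] unfolding H_def by blast
  obtain root where root: "\<And>y. y \<in> P \<Longrightarrow> root y \<in> H \<and> root y [^] d = y"
  proof -
    have "\<forall>y\<in>P. \<exists>x. x \<in> H \<and> x [^] d = y" unfolding P_def by auto
    then show ?thesis using that bchoice by metis
  qed
  \<comment> \<open>The \<open>d\<close>-th power of \<open>t \<otimes> root y\<close> is
    \<open>y\<close>, which recovers the pair. Hence \<open>card K * card P\<close> is at most
    \<open>card H\<close>, which in turn is at most \<open>card T * card P\<close>; then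
    \<open>card P\<close> cancels.\<close>
  have "inj_on (\<lambda>(t, y). t \<otimes> root y) (K \<times> P)"
  proof (rule inj_onI, clarify)
    fix t y t' y'
    assume t: "t \<in> K" "t' \<in> K" and y: "y \<in> P" "y' \<in> P" and eq: "t \<otimes> root y = t' \<otimes> root y'"
    have c: "t \<in> carrier G" "t' \<in> carrier G" "root y \<in> carrier G" "root y' \<in> carrier G"
      using t y root Hc by (auto simp: K_def)
    have "(t \<otimes> root y) [^] d = y" "(t' \<otimes> root y') [^] d = y'"
      using c t root y Hc by (auto simp: nat_pow_distrib K_def P_def)
    with eq have "y = y'" by simp
    with eq c show "t = t' \<and> y = y'" by simp
  qed
  moreover have "(\<lambda>(t, y). t \<otimes> root y) ` (K \<times> P) \<subseteq> H"
    using root subgroup.m_closed[OF sub] by (auto simp: K_def)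
  ultimately have "card K * card P \<le> card H"
    using card_inj_on_le[of _ "K \<times> P" H] fin by (simp add: card_cartesian_product)
  also have "card H \<le> card ((\<lambda>(t, y). t \<otimes> y) ` (T \<times> P))"
    using T fin by (intro card_mono) (fastforce simp: P_def image_iff)+
  also have "\<dots> \<le> card (T \<times> P)" using T fin by (intro card_image_le) (auto simp: P_def)
  also have "\<dots> \<le> d ^ card A * card P" using T(2) by (simp add: card_cartesian_product)
  finally have "card K * card P \<le> d ^ card A * card P" .
  moreover have "card P > 0"
    using fin subgroup.one_closed[OF sub] by (auto simp: P_def card_gt_0_iff)
  ultimately show ?thesis by (simp add: K_def H_def)
qed

text \<open>If some torsion element \<open>t\<close> lies outside \<open>H\<close>, any other one
  outside \<open>H\<close> lies in the same coset and differs from \<open>t\<close> by a torsion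
  element of \<open>H\<close>. So one translate of the torsion of \<open>H\<close> suffices.\<close>

lemma card_torsion_le_double:
  assumes "finite (carrier G)" "subgroup H G" "c \<in> carrier G"
    and "\<forall>x \<in> carrier G. x \<in> H \<or> x \<otimes> c \<in> H"
  shows "card {x \<in> carrier G. x [^] (d::nat) = \<one>} \<le> 2 * card {x \<in> H. x [^] d = \<one>}"
proof -
  define K where "K = {x \<in> H. x [^] d = \<one>}"
  have Hc: "H \<subseteq> carrier G" using subgroup.subset[OF assms(2)] .
  have fin: "finite K" using Hc assms(1) finite_subset[of K "carrier G"] by (auto simp: K_def)
  obtain t where t: "{x \<in> carrier G. x [^] d = \<one>} \<subseteq> K \<union> (\<lambda>h. h \<otimes> t) ` K"
  proof (cases "\<exists>t \<in> carrier G - H. t [^] d = \<one>")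
    case False
    then show ?thesis using that[of \<one>] by (auto simp: K_def)
  next
    case True
    then obtain t where t: "t \<in> carrier G" "t \<notin> H" "t [^] d = \<one>" by blast
    have "x \<in> K \<union> (\<lambda>h. h \<otimes> t) ` K" if x: "x \<in> carrier G" "x [^] d = \<one>" for x
    proof (cases "x \<in> H")
      case False
      have "(x \<otimes> c) \<otimes> inv (t \<otimes> c) \<in> H"
        using assms(2,4) False t x subgroup.m_closed subgroup.m_inv_closed by metis
      moreover have "(x \<otimes> c) \<otimes> inv (t \<otimes> c) = (c \<otimes> inv c) \<otimes> (x \<otimes> inv t)"
        using x t assms(3) by (simp add: inv_mult m_ac del: r_inv Units_r_inv)
      ultimately have "x \<otimes> inv t \<in> H" using x t assms(3) by simp
      then have "x \<otimes> inv t \<in> K"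
        using x t by (simp add: K_def nat_pow_distrib nat_pow_inv)
      moreover have "x = (x \<otimes> inv t) \<otimes> t" using x t by (simp add: m_assoc)
      ultimately show ?thesis by blast
    qed (use x in \<open>simp add: K_def\<close>)
    then show ?thesis using that by blast
  qed
  have "card {x \<in> carrier G. x [^] d = \<one>} \<le> card (K \<union> (\<lambda>h. h \<otimes> t) ` K)"
    using t fin by (intro card_mono) auto
  also have "\<dots> \<le> card K + card ((\<lambda>h. h \<otimes> t) ` K)" by (rule card_Un_le)
  also have "\<dots> \<le> 2 * card K" using card_image_le[OF fin, of "\<lambda>h. h \<otimes> t"] by simp
  finally show ?thesis by (simp add: K_def)
qed

end

section \<open>Invariant factors: generators, order and torsion\<close>

lemma nat_pow_product_group:
  "x [^]\<^bsub>product_group I G\<^esub> (n::nat) = (\<lambda>i\<in>I. x i [^]\<^bsub>G i\<^esub> n)"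
  by (induction n) auto

definition unit_vec :: "nat \<Rightarrow> nat \<Rightarrow> nat \<Rightarrow> int" where
  "unit_vec r i = (\<lambda>j\<in>{..<r}. if j = i then 1 else 0)"

lemma unit_vec_in_carrier:
  assumes "\<forall>m \<in> set ms. 1 < m"
  shows "unit_vec (length ms) i \<in>
    carrier (product_group {..<length ms} (\<lambda>i. integer_mod_group (ms ! i)))"
  using assms by (fastforce simp: unit_vec_def dest: nth_mem)

lemma unit_vec_pow:
  fixes ms :: "nat list" and n :: nat
  assumes "\<forall>m \<in> set ms. 1 < m"
  defines "P \<equiv> product_group {..<length ms} (\<lambda>i. integer_mod_group (ms ! i))"
  shows "unit_vec (length ms) i [^]\<^bsub>P\<^esub> n =
    (\<lambda>j\<in>{..<length ms}. if j = i then int n mod int (ms ! j) else 0)"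
  unfolding P_def using assms(1)
  by (subst nat_pow_product_group) (auto simp: unit_vec_def intro!: restrict_ext)

lemma generate_unit_vecs:
  fixes ms :: "nat list"
  assumes "\<forall>m \<in> set ms. 1 < m"
  defines "P \<equiv> product_group {..<length ms} (\<lambda>i. integer_mod_group (ms ! i))"
  shows "generate P (unit_vec (length ms) ` {..<length ms}) = carrier P"
proof -
  define U where "U = unit_vec (length ms) ` {..<length ms}"
  interpret P: group P unfolding P_def by simp
  have U: "U \<subseteq> carrier P"
    using unit_vec_in_carrier[OF assms(1)] unfolding U_def P_def by auto
  have m: "ms ! i > 1" if "i < length ms" for i using that assms(1) by simp
  \<comment> \<open>Induction on \<open>k\<close>, where only the first \<open>k\<close> coordinates
    may be nonzero. The step clears coordinate \<open>k\<close> and restores it by a power of a unit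
    vector.\<close>
  have "x \<in> generate P U"
    if "k \<le> length ms" "x \<in> carrier P" "\<forall>i<length ms. k \<le> i \<longrightarrow> x i = 0" for k x
    using that
  proof (induction k arbitrary: x)
    case 0
    then have "x = \<one>\<^bsub>P\<^esub>"
      by (auto simp: P_def PiE_iff extensional_def restrict_def)
    then show ?case using generate.one by metis
  next
    case (Suc k)
    have k: "k < length ms" using Suc.prems(1) by simp
    have x: "x i \<in> {0..<int (ms ! i)}" if i: "i < length ms" for i
    proof -
      have "x i \<in> carrier (integer_mod_group (ms ! i))"
        using Suc.prems(2) i by (auto simp: P_def)
      then show ?thesis using m[OF i] by (simp add: carrier_integer_mod_group)
    qed
    have ext: "x \<in> extensional {..<length ms}" using Suc.prems(2) by (simp add: P_def PiE_def)
    define y where "y = x(k := 0)"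
    have "y \<in> (\<Pi>\<^sub>E i\<in>insert k {..<length ms}. carrier (integer_mod_group (ms ! i)))"
      unfolding y_def using Suc.prems(2) by (intro PiE_fun_upd) (simp_all add: P_def)
    then have "y \<in> carrier P" using k by (simp add: P_def insert_absorb)
    moreover have "\<forall>i<length ms. k \<le> i \<longrightarrow> y i = 0"
      using Suc.prems(3) by (simp add: y_def)
    ultimately have y: "y \<in> generate P U" using Suc.IH k by simp
    define z where "z = unit_vec (length ms) k [^]\<^bsub>P\<^esub> nat (x k)"
    have z_eq: "z = (\<lambda>j\<in>{..<length ms}. if j = k then x k else 0)"
      unfolding z_def P_def unit_vec_pow[OF assms(1)] using x[OF k]
      by (auto intro!: restrict_ext)
    have "unit_vec (length ms) k \<in> generate P U"
      using k unfolding U_def by (intro generate.incl) auto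
    then have "z \<in> generate P U"
      unfolding z_def
      using P.subgroup_int_pow_closed[OF P.generate_is_subgroup[OF U], of _ "int (nat (x k))"]
      by (metis int_pow_int)
    with y have "y \<otimes>\<^bsub>P\<^esub> z \<in> generate P U" by (rule generate.eng)
    moreover have "y \<otimes>\<^bsub>P\<^esub> z = x"
    proof
      fix i
      show "(y \<otimes>\<^bsub>P\<^esub> z) i = x i"
        using x[of i] ext unfolding z_eq
        by (auto simp: P_def y_def extensional_def)
    qed
    ultimately show ?case by simp
  qed
  from this[of "length ms"] show ?thesis
    using P.generate_incl[OF U] unfolding U_def by auto
qed

text \<open>In factor \<open>i\<close> the \<open>d\<close> multiples of \<open>ms ! i div d\<close>
  are killed by \<open>d\<close>; the tuples of such multiples are already
  \<open>d ^ length ms\<close> torsion elements.\<close>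

lemma card_torsion_product_ge:
  fixes ms :: "nat list" and d :: nat
  assumes "\<forall>m \<in> set ms. 1 < m" "\<forall>m \<in> set ms. d dvd m"
  defines "P \<equiv> product_group {..<length ms} (\<lambda>i. integer_mod_group (ms ! i))"
  shows "d ^ length ms \<le> card {x \<in> carrier P. x [^]\<^bsub>P\<^esub> d = \<one>\<^bsub>P\<^esub>}"
proof -
  define T where "T i = (\<lambda>c. int c * int (ms ! i div d)) ` {..<d}" for i
  have m: "ms ! i > 1" "d * (ms ! i div d) = ms ! i" "d > 0" if "i < length ms" for i
  proof -
    show m1: "ms ! i > 1" using that assms(1) by simp
    have "d dvd ms ! i" using that assms(2) by simp
    then show "d * (ms ! i div d) = ms ! i" by simp
    with m1 show "d > 0" by (intro Nat.gr0I) auto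
  qed
  have card_T: "card (T i) = d" if "i < length ms" for i
  proof -
    have "ms ! i div d \<noteq> 0" using m[OF that] by (metis mult_0_right not_one_less_zero)
    then have "inj_on (\<lambda>c. int c * int (ms ! i div d)) {..<d}" by (intro inj_onI) simp
    then show ?thesis by (simp add: T_def card_image)
  qed
  have T: "0 \<le> t \<and> t < int (ms ! i) \<and> int d * t mod int (ms ! i) = 0"
    if i: "i < length ms" and t: "t \<in> T i" for i t
  proof -
    obtain c where c: "c < d" "t = int (c * (ms ! i div d))" using t by (auto simp: T_def)
    have "ms ! i div d > 0" using m[OF i] by (metis gr0I mult_0_right not_one_less_zero)
    then have "c * (ms ! i div d) < d * (ms ! i div d)" using c by simp
    moreover have "d * (c * (ms ! i div d)) = c * ms ! i"
      using m(2)[OF i] by (metis mult.left_commute)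
    ultimately show ?thesis
      using c m(2)[OF i] by (metis mod_mult_self2_is_0 of_nat_0_le_iff of_nat_less_iff of_nat_mult)
  qed
  have "PiE {..<length ms} T \<subseteq> {x \<in> carrier P. x [^]\<^bsub>P\<^esub> d = \<one>\<^bsub>P\<^esub>}"
  proof
    fix x assume x: "x \<in> PiE {..<length ms} T"
    have "x \<in> carrier P"
      using x T m(1) by (fastforce simp: P_def PiE_iff carrier_integer_mod_group)
    moreover have "x [^]\<^bsub>P\<^esub> d = \<one>\<^bsub>P\<^esub>"
      using \<open>x \<in> carrier P\<close> x T unfolding P_def
      by (subst nat_pow_product_group) (auto intro!: restrict_ext)
    ultimately show "x \<in> {x \<in> carrier P. x [^]\<^bsub>P\<^esub> d = \<one>\<^bsub>P\<^esub>}" by simp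
  qed
  moreover have "finite (carrier P)"
    unfolding P_def using m(1)
    by (fastforce simp: carrier_integer_mod_group intro!: finite_PiE)
  ultimately have "card (PiE {..<length ms} T) \<le> card {x \<in> carrier P. x [^]\<^bsub>P\<^esub> d = \<one>\<^bsub>P\<^esub>}"
    by (intro card_mono) auto
  moreover have "card (PiE {..<length ms} T) = d ^ length ms"
    by (simp add: card_PiE card_T)
  ultimately show ?thesis by simp
qed

lemma has_type_generators:
  assumes "group G" "has_type G ms"
  obtains e where
    "\<forall>i<length ms. e i \<in> carrier G \<and> e i [^]\<^bsub>G\<^esub> (ms ! i) = \<one>\<^bsub>G\<^esub>"
    "generate G (e ` {..<length ms}) = carrier G"
proof -
  define P where "P = product_group {..<length ms} (\<lambda>i. integer_mod_group (ms ! i))"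
  have m: "\<forall>m \<in> set ms. 1 < m" using assms(2) by (simp add: has_type_def)
  interpret P: group P unfolding P_def by simp
  interpret G: group G by fact
  obtain f where "f \<in> iso G P" using assms(2) by (auto simp: has_type_def is_iso_def P_def)
  then obtain g where g: "g \<in> iso P G" using G.iso_set_sym by blast
  interpret g: group_hom P G g
    using g by (intro group_hom.intro group_hom_axioms.intro) (auto simp: iso_def P.is_group G.is_group)
  define u where "u = unit_vec (length ms)"
  have u: "u i \<in> carrier P" for i
    unfolding u_def P_def using m by (rule unit_vec_in_carrier)
  show thesis
  proof (rule that[of "g \<circ> u"])
    have "u i [^]\<^bsub>P\<^esub> (ms ! i) = \<one>\<^bsub>P\<^esub>" for i
      unfolding u_def P_def unit_vec_pow[OF m] by (auto intro!: restrict_ext)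
    then have "(g \<circ> u) i [^]\<^bsub>G\<^esub> (ms ! i) = \<one>\<^bsub>G\<^esub>" for i
      using g.hom_nat_pow[OF u[of i], of "ms ! i"] by simp
    then show "\<forall>i<length ms. (g \<circ> u) i \<in> carrier G \<and>
        (g \<circ> u) i [^]\<^bsub>G\<^esub> (ms ! i) = \<one>\<^bsub>G\<^esub>"
      using u by simp
  next
    have "generate G (g ` u ` {..<length ms}) = g ` carrier P"
      using g.generate_img[of "u ` {..<length ms}"] u generate_unit_vecs[OF m]
      unfolding u_def P_def by auto
    also have "\<dots> = carrier G" using g by (auto simp: iso_def bij_betw_def)
    finally show "generate G ((g \<circ> u) ` {..<length ms}) = carrier G" by (simp add: image_comp)
  qed
qed

lemma order_has_type:
  assumes "has_type G ms"
  shows "order G = (\<Prod>i<length ms. ms ! i)"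
proof -
  have "order G = card (carrier (product_group {..<length ms} (\<lambda>i. integer_mod_group (ms ! i))))"
    using assms iso_same_card unfolding has_type_def order_def by blast
  also have "\<dots> = (\<Prod>i<length ms. card (carrier (integer_mod_group (ms ! i))))"
    by (simp add: card_PiE)
  also have "\<dots> = (\<Prod>i<length ms. ms ! i)"
    using assms by (intro prod.cong) (auto simp: has_type_def carrier_integer_mod_group)
  finally show ?thesis .
qed

lemma card_torsion_ge:
  assumes "group G" "finite (carrier G)" "has_type G ms" "\<forall>m \<in> set ms. d dvd m"
  shows "d ^ length ms \<le> card {x \<in> carrier G. x [^]\<^bsub>G\<^esub> (d::nat) = \<one>\<^bsub>G\<^esub>}"
proof -
  define P where "P = product_group {..<length ms} (\<lambda>i. integer_mod_group (ms ! i))"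
  have m: "\<forall>m \<in> set ms. 1 < m" using assms(3) by (simp add: has_type_def)
  interpret P: group P unfolding P_def by simp
  interpret G: group G by fact
  obtain f where "f \<in> iso G P" using assms(3) by (auto simp: has_type_def is_iso_def P_def)
  then obtain g where g: "g \<in> iso P G" using G.iso_set_sym by blast
  interpret g: group_hom P G g
    using g by (intro group_hom.intro group_hom_axioms.intro) (auto simp: iso_def P.is_group G.is_group)
  have "d ^ length ms \<le> card {x \<in> carrier P. x [^]\<^bsub>P\<^esub> d = \<one>\<^bsub>P\<^esub>}"
    unfolding P_def using m assms(4) by (rule card_torsion_product_ge)
  also have "\<dots> \<le> card {x \<in> carrier G. x [^]\<^bsub>G\<^esub> d = \<one>\<^bsub>G\<^esub>}"
  proof (rule card_inj_on_le)
    show "inj_on g {x \<in> carrier P. x [^]\<^bsub>P\<^esub> d = \<one>\<^bsub>P\<^esub>}"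
      using g by (auto simp: iso_def bij_betw_def inj_on_def)
    show "g ` {x \<in> carrier P. x [^]\<^bsub>P\<^esub> d = \<one>\<^bsub>P\<^esub>} \<subseteq> {x \<in> carrier G. x [^]\<^bsub>G\<^esub> d = \<one>\<^bsub>G\<^esub>}"
      by (auto simp flip: g.hom_nat_pow)
  qed (use assms(2) in simp)
  finally show ?thesis .
qed

lemma has_type_hd_dvd:
  assumes "has_type G ms" "m \<in> set ms"
  shows "ms ! 0 dvd m"
proof -
  have "ms ! 0 dvd ms ! i" if "i < length ms" for i
    using that
  proof (induction i)
    case (Suc i)
    then have "ms ! i dvd ms ! Suc i" using assms(1) by (simp add: has_type_def)
    with Suc show ?case by (meson Suc_lessD dvd_trans)
  qed simp
  then show ?thesis using assms(2) by (auto simp: in_set_conv_nth)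
qed

section \<open>Attained minima: \<open>s_min\<close> and \<open>group_rank\<close>\<close>

lemma finite_hamiltonian_sums:
  assumes "finite (carrier G)"
  shows "finite {card (consecutive_sums G C) | C. C \<in> hamiltonian_cycles G}"
proof -
  have "finite {C. set C \<subseteq> carrier G \<and> distinct C}"
    by (rule finite_subset_distinct[OF assms])
  then have "finite (hamiltonian_cycles G)"
    by (rule rev_finite_subset) (auto simp: hamiltonian_cycles_def)
  then show ?thesis by simp
qed

lemma s_min_le:
  assumes "finite (carrier G)" "distinct C" "set C = carrier G"
  shows "s_min G \<le> card (consecutive_sums G C)"
  unfolding s_min_def using assms
  by (intro Min_le finite_hamiltonian_sums) (auto simp: hamiltonian_cycles_def)

lemma s_min_attained:
  assumes "finite (carrier G)"
  obtains C where "set C = carrier G" "s_min G = card (consecutive_sums G C)"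
proof -
  obtain C where "C \<in> hamiltonian_cycles G"
    using finite_distinct_list[OF assms] by (auto simp: hamiltonian_cycles_def)
  then have "s_min G \<in> {card (consecutive_sums G C) | C. C \<in> hamiltonian_cycles G}"
    unfolding s_min_def by (intro Min_in finite_hamiltonian_sums assms) auto
  then show thesis using that by (auto simp: hamiltonian_cycles_def)
qed

lemma group_rank_le:
  assumes "finite A" "A \<subseteq> carrier G" "generate G A = carrier G"
  shows "group_rank G \<le> card A"
  unfolding group_rank_def using assms by (intro Least_le) auto

lemma group_rank_attained:
  assumes "group G" "finite (carrier G)"
  obtains A where "finite A" "A \<subseteq> carrier G" "generate G A = carrier G" "card A = group_rank G"
proof -
  have "generate G (carrier G) = carrier G"
    using group.generate_incl[OF assms(1)] generate.incl[of _ "carrier G" G] by blast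
  then have "\<exists>A. A \<subseteq> carrier G \<and> finite A \<and> card A = card (carrier G) \<and> generate G A = carrier G"
    using assms(2) by auto
  then have "\<exists>A. A \<subseteq> carrier G \<and> finite A \<and> card A = group_rank G \<and> generate G A = carrier G"
    unfolding group_rank_def by (rule LeastI)
  then show thesis using that by blast
qed

section \<open>Comparison of \<open>s_min\<close> with the rank\<close>

context comm_group
begin

text \<open>The first factor \<open>d\<close> divides all the others, so there are at least
  \<open>d ^ length ms\<close> elements of \<open>d\<close>-torsion, while a generating set of
  minimal size allows at most \<open>d ^ group_rank G\<close>.\<close>

lemma group_rank_has_type:
  assumes "finite (carrier G)" "has_type G ms" "ms \<noteq> []"
  shows "group_rank G = length ms"
proof (rule antisym)
  obtain e where e: "\<forall>i<length ms. e i \<in> carrier G \<and> e i [^] (ms ! i) = \<one>"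
    "generate G (e ` {..<length ms}) = carrier G"
    using has_type_generators[OF is_group assms(2)] .
  have "group_rank G \<le> card (e ` {..<length ms})"
    using e by (intro group_rank_le) auto
  also have "\<dots> \<le> length ms" using card_image_le[of "{..<length ms}" e] by simp
  finally show "group_rank G \<le> length ms" .
next
  define d where "d = ms ! 0"
  have d: "d > 1" using assms(2,3) by (simp add: d_def has_type_def)
  obtain A where A: "finite A" "A \<subseteq> carrier G" "generate G A = carrier G" "card A = group_rank G"
    using group_rank_attained[OF is_group assms(1)] .
  have "d ^ length ms \<le> card {x \<in> carrier G. x [^] d = \<one>}"
    unfolding d_def using has_type_hd_dvd[OF assms(2)]
    by (intro card_torsion_ge[OF is_group assms(1,2)]) blast
  also have "\<dots> \<le> d ^ group_rank G"
    using card_torsion_generate_le[OF assms(1) A(1,2), of d] A(3,4) d by simp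
  finally show "length ms \<le> group_rank G" using d by (simp add: power_increasing_iff)
qed

text \<open>Adjoining \<open>c\<close> to \<open>D\<close> yields the whole group, and
  \<open>D\<close> has fewer elements than there are sums.\<close>

lemma group_rank_le_s_min:
  assumes "finite (carrier G)"
  shows "group_rank G \<le> s_min G"
proof -
  obtain C where C: "set C = carrier G" "s_min G = card (consecutive_sums G C)"
    using s_min_attained[OF assms] .
  obtain D c where D: "finite D" "D \<subseteq> carrier G" "c \<in> carrier G"
    "card D < card (consecutive_sums G C)"
    "\<forall>x \<in> carrier G. x \<in> generate G D \<or> x \<otimes> c \<in> generate G D"
    using carrier_almost_generated_by_differences[OF assms C(1)] .
  have cD: "insert c D \<subseteq> carrier G" using D by auto
  have sub: "subgroup (generate G (insert c D)) G" by (rule generate_is_subgroup[OF cD])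
  have mono: "generate G D \<subseteq> generate G (insert c D)" by (rule mono_generate) auto
  have "x \<in> generate G (insert c D)" if x: "x \<in> carrier G" for x
  proof (cases "x \<in> generate G D")
    case False
    then have "x \<otimes> c \<in> generate G (insert c D)" using D(5) x mono by blast
    moreover have "inv c \<in> generate G (insert c D)" by (rule generate.inv) simp
    ultimately have "(x \<otimes> c) \<otimes> inv c \<in> generate G (insert c D)"
      by (rule generate.eng)
    then show ?thesis using x D(3) by (simp add: m_assoc)
  qed (use mono in blast)
  then have "generate G (insert c D) = carrier G" using generate_incl[OF cD] by blast
  then have "group_rank G \<le> card (insert c D)" using D(1) cD by (intro group_rank_le) auto
  then show ?thesis using D(1,4) C(2) by (simp add: card_insert_if split: if_splits)
qed

text \<open>A group of odd order has no subgroup of index two, so \<open>D\<close> alone generates.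
  Concretely, \<open>x\<close> is a power of its square because \<open>order G + 1\<close> is
  even.\<close>

lemma group_rank_less_s_min_if_odd:
  assumes "finite (carrier G)" "odd (order G)"
  shows "group_rank G < s_min G"
proof -
  obtain C where C: "set C = carrier G" "s_min G = card (consecutive_sums G C)"
    using s_min_attained[OF assms(1)] .
  obtain D c where D: "finite D" "D \<subseteq> carrier G" "c \<in> carrier G"
    "card D < card (consecutive_sums G C)"
    "\<forall>x \<in> carrier G. x \<in> generate G D \<or> x \<otimes> c \<in> generate G D"
    using carrier_almost_generated_by_differences[OF assms(1) C(1)] .
  define H where "H = generate G D"
  have sub: "subgroup H G" unfolding H_def by (rule generate_is_subgroup[OF D(2)])
  \<comment> \<open>If \<open>x\<close> and its square were both outside \<open>H\<close>, they
    would share the other coset, and their quotient \<open>x\<close> would lie in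
    \<open>H\<close>.\<close>
  have square: "x \<otimes> x \<in> H" if x: "x \<in> carrier G" "x \<notin> H" for x
  proof (rule ccontr)
    assume "x \<otimes> x \<notin> H"
    then have "(x \<otimes> x) \<otimes> c \<in> H" "x \<otimes> c \<in> H" using D(5) x unfolding H_def by auto
    then have "((x \<otimes> x) \<otimes> c) \<otimes> inv (x \<otimes> c) \<in> H"
      using subgroup.m_closed[OF sub] subgroup.m_inv_closed[OF sub] by blast
    moreover have "((x \<otimes> x) \<otimes> c) \<otimes> inv (x \<otimes> c) = x" using x D(3) by (simp add: m_assoc)
    ultimately show False using x by simp
  qed
  have "x \<in> H" if x: "x \<in> carrier G" for x
  proof (rule ccontr)
    assume "x \<notin> H"
    then have sq: "x [^] (2::nat) \<in> H" using square[OF x] x by (simp add: numeral_2_eq_2)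
    obtain k where k: "order G + 1 = 2 * k" using assms(2) by (metis evenE odd_add odd_one)
    have "x = x [^] (order G + 1)" using x pow_order_eq_1[OF x] by simp
    also have "\<dots> = (x [^] (2::nat)) [^] k" unfolding k using x by (simp add: nat_pow_pow)
    also have "\<dots> \<in> H"
      using subgroup_int_pow_closed[OF sub sq, of "int k"] by (simp add: int_pow_int)
    finally show False using \<open>x \<notin> H\<close> by simp
  qed
  then have "generate G D = carrier G" using subgroup.subset[OF sub] unfolding H_def by blast
  then have "group_rank G \<le> card D" using D(1,2) by (intro group_rank_le) auto
  then show ?thesis using D(4) C(2) by simp
qed

text \<open>The factor 2 lost to the index of the subgroup is smaller than \<open>d\<close>, so it
  cannot make up for a missing generator.\<close>

lemma length_type_less_s_min:
  assumes "finite (carrier G)" "has_type G ms" "ms \<noteq> []" "ms ! 0 \<noteq> 2"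
  shows "length ms < s_min G"
proof -
  define d where "d = ms ! 0"
  have "d > 1" using assms(2,3) by (simp add: d_def has_type_def)
  with assms(4) have d: "d > 2" by (simp add: d_def)
  obtain C where C: "set C = carrier G" "s_min G = card (consecutive_sums G C)"
    using s_min_attained[OF assms(1)] .
  obtain D c where D: "finite D" "D \<subseteq> carrier G" "c \<in> carrier G"
    "card D < card (consecutive_sums G C)"
    "\<forall>x \<in> carrier G. x \<in> generate G D \<or> x \<otimes> c \<in> generate G D"
    using carrier_almost_generated_by_differences[OF assms(1) C(1)] .
  have "d ^ length ms \<le> card {x \<in> carrier G. x [^] d = \<one>}"
    unfolding d_def using has_type_hd_dvd[OF assms(2)]
    by (intro card_torsion_ge[OF is_group assms(1,2)]) blast
  also have "\<dots> \<le> 2 * card {x \<in> generate G D. x [^] d = \<one>}"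
    using assms(1) generate_is_subgroup[OF D(2)] D(3,5) by (rule card_torsion_le_double)
  also have "\<dots> \<le> 2 * d ^ card D"
    using card_torsion_generate_le[OF assms(1) D(1,2), of d] d by simp
  also have "\<dots> < d ^ Suc (card D)" using d by simp
  finally have "length ms < Suc (card D)" using d by (simp add: power_strict_increasing_iff del: power_Suc)
  then show ?thesis using D(4) C(2) by simp
qed

lemma s_min_le_if_has_type:
  assumes "finite (carrier G)" "has_type G ms" "j < length ms" "even (ms ! j)"
  shows "s_min G \<le> (if ms ! j = 2 then length ms else length ms + 1)"
proof -
  obtain e where e: "\<forall>i<length ms. e i \<in> carrier G \<and> e i [^] (ms ! i) = \<one>"
    "generate G (e ` {..<length ms}) = carrier G"
    using has_type_generators[OF is_group assms(2)] .
  have pos: "ms ! i > 0" if "i < length ms" for i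
    using assms(2) that nth_mem[OF that] unfolding has_type_def by fastforce
  have "\<exists>C. length C = (\<Prod>i<length ms. ms ! i) \<and> set C = generate G (e ` {..<length ms}) \<and>
    card (consecutive_sums G C) \<le>
      (if ms ! j = 2 then card {..<length ms} else card {..<length ms} + 1)"
    using e(1) pos assms(3,4) by (intro even_cycle_exists) simp_all
  then obtain C where C: "length C = (\<Prod>i<length ms. ms ! i)"
    "set C = generate G (e ` {..<length ms})"
    "card (consecutive_sums G C) \<le> (if ms ! j = 2 then length ms else length ms + 1)"
    unfolding card_lessThan by blast
  \<comment> \<open>The length is the product of the factors, hence the group order; a list of that
    length covering the group has no repetition.\<close>
  have "length C = card (set C)"
    using C(1,2) e(2) order_has_type[OF assms(2)] by (simp add: order_def)
  then have "distinct C" by (simp add: card_distinct)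
  then have "s_min G \<le> card (consecutive_sums G C)"
    using assms(1) C(2) e(2) by (intro s_min_le) auto
  with C(3) show ?thesis by linarith
qed

end

theorem theorem4:
  fixes G :: "('a, 'b) monoid_scheme"
  assumes "comm_group G"
    and "finite (carrier G)"
    and "carrier G \<noteq> {\<one>\<^bsub>G\<^esub>}"
  shows "(even (order G) \<longrightarrow>
            (\<forall>ms. has_type G ms \<longrightarrow>
               s_min G = (if ms ! 0 = 2 then group_rank G else group_rank G + 1))) \<and>
         (odd (order G) \<longrightarrow>
            group_rank G + 1 \<le> s_min G \<and> s_min G \<le> 2 * group_rank G + 1)"
proof (intro conjI impI allI)
  interpret comm_group G by fact
  fix ms assume ev: "even (order G)" and ms: "has_type G ms"
  have "\<exists>j\<in>{..<length ms}. even (ms ! j)"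
    using ev unfolding order_has_type[OF ms] by (simp only: even_prod_iff finite_lessThan)
  then obtain j where j: "j < length ms" "even (ms ! j)" by blast
  then have ne: "ms \<noteq> []" by auto
  show "s_min G = (if ms ! 0 = 2 then group_rank G else group_rank G + 1)"
  proof (cases "ms ! 0 = 2")
    case True
    then have "s_min G \<le> group_rank G"
      using s_min_le_if_has_type[OF assms(2) ms, of 0] ne group_rank_has_type[OF assms(2) ms ne] by simp
    with True group_rank_le_s_min[OF assms(2)] show ?thesis by simp
  next
    case False
    \<comment> \<open>For \<open>ms ! j = 2\<close> the upper bound would contradict the strict
      lower bound, so only the bound \<open>length ms + 1\<close> remains.\<close>
    then show ?thesis
      using s_min_le_if_has_type[OF assms(2) ms j] length_type_less_s_min[OF assms(2) ms ne]
        group_rank_has_type[OF assms(2) ms ne] by (auto split: if_splits)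
  qed
next
  interpret comm_group G by fact
  assume od: "odd (order G)"
  then show "group_rank G + 1 \<le> s_min G"
    using group_rank_less_s_min_if_odd[OF assms(2)] by simp
  obtain A where A: "finite A" "A \<subseteq> carrier G" "generate G A = carrier G" "card A = group_rank G"
    using group_rank_attained[OF is_group assms(2)] .
  obtain C where C: "distinct C" "set C = carrier G" "card (consecutive_sums G C) \<le> 2 * card A + 1"
    using odd_cycle_exists[OF assms(2) od A(1,2)] A(3) by auto
  then show "s_min G \<le> 2 * group_rank G + 1"
    using s_min_le[OF assms(2) C(1,2)] A(4) by simp
qed

end
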